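(* Let $KB=\langle P,Ab,IC,K\rangle$ be a Horn knowledge base with $IC=\emptyset$, and let $\dotplus$ be a revision function satisfying all the rationality postulates $(\dotplus1)$ to $(\dotplus7)$. Define a revision operator $*$ on $KB^{\bullet}$ by $KB^{\bullet}*\alpha=(KB\dotplus\alpha)^{\bullet}$ for every sentence $\alpha$. Then $*$ satisfies all the AGM postulates for revision $( *1)$ to $( *8)$.
   Context: Fix a first-order language $\mathcal{L}$; "sentence" means a sentence of $\mathcal{L}$. A Horn knowledge base is a tuple $KB=\langle P,Ab,IC,K\rangle$ where: $P$ is an acyclic normal logic program (there is a level mapping from ground atoms to $\mathbb{N}$ such that in every ground clause $H\leftarrow L_1,\dots,L_n$ of $P$ the level of $H$ exceeds that of each $L_i$, with $|\neg A|=|A|$), all abducibles at level $0$ and no non-abducible at level $0$; $Ab$ is a set of atoms (abducibles); $IC$ is a set of sentences (integrity constraints); $K$ is a set of sentences whose atoms are all in $Ab$. An abductive interpretation is a set $I\subseteq Ab$. A level-$0$ atom $A$ is true in $I$ iff $A\in I$; an atom $A$ of level $n>0$ is true in $I$ iff some clause $A\leftarrow L_1,\dots,L_k$ of the ground instantiation of $P$ has all positive $L_j$ true in $I$ and, for every negative $L_j=\neg B_j$, $B_j$ false in $I$. Truth extends to sentences classically ($\forall$/$\exists$ via ground instances). $Mod(X)$ is the set of abductive interpretations making the sentence (or all sentences of the set) $X$ true; $Cn_P(X)=\{\alpha: Mod(X)\subseteq Mod(\alpha)\}$; $Mod(KB)=Mod(K\cup IC)$; $KB^\bullet=Cn_P(K\cup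 IC)$; $\alpha$ is accepted in $KB$ iff $\alpha\in KB^\bullet$. $KB_1\equiv KB_2$ iff $P_1=P_2,Ab_1=Ab_2,IC_1=IC_2$ and $Mod(K_1)=Mod(K_2)$. $Mod(KB+\alpha)=Mod(KB)\cap Mod(\alpha)$. Revision postulates for $KB\dotplus\alpha=\langle P',Ab',IC',K'\rangle$: $(\dotplus1)$ $P'=P,Ab'=Ab,IC'=IC$; $(\dotplus2)$ $\alpha$ accepted in $KB\dotplus\alpha$; $(\dotplus3)$ $Mod(\{\alpha\}\cup IC)\neq\emptyset$ iff $Mod(KB\dotplus\alpha)\neq\emptyset$; $(\dotplus4)$ if $\neg\alpha$ is not accepted in $KB$ then $Mod(KB\dotplus\alpha)=Mod(KB)\cap Mod(\alpha)$; $(\dotplus5)$ if $KB\equiv KB'$ and $Mod(\alpha)=Mod(\beta)$ then $Mod(KB\dotplus\alpha)=Mod(KB'\dotplus\beta)$; $(\dotplus6)$ $Mod(KB\dotplus\alpha)\cap Mod(\beta)\subseteq Mod(KB\dotplus(\alpha\land\beta))$; $(\dotplus7)$ if $\neg\beta$ is not accepted in $KB\dotplus\alpha$ then $Mod(KB\dotplus(\alpha\land\beta))\subseteq Mod(KB\dotplus\alpha)\cap Mod(\beta)$. AGM setting (with respect to $Cn_P$): a belief set is a set $T$ of sentences with $T=Cn_P(T)$; $T\#\alpha=Cn_P(T\cup\{\alpha\})$; $T$ is inconsistent iff some $\varphi$ and $\neg\varphi$ both lie in $T$; $\vdash\varphi$ means $\varphi\in Cn_P(\emptyset)$. AGM revision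 postulates for $T=KB^\bullet$: $( *1)$ $T*\alpha$ is a belief set; $( *2)$ $\alpha\in T*\alpha$; $( *3)$ $T*\alpha\subseteq T\#\alpha$; $( *4)$ if $\neg\alpha\notin T$ then $T\#\alpha\subseteq T*\alpha$; $( *5)$ $T*\alpha$ is inconsistent iff $\vdash\neg\alpha$; $( *6)$ if $\vdash\alpha\leftrightarrow\beta$ then $T*\alpha=T*\beta$; $( *7)$ $T*(\alpha\land\beta)\subseteq(T*\alpha)\#\beta$; $( *8)$ if $\neg\beta\notin T*\alpha$ then $(T*\alpha)\#\beta\subseteq T*(\alpha\land\beta)$. *)

theory Defs
  imports Main
begin

section \<open>First-order syntax\<close>

datatype 'f tm = Var nat | Fun 'f "'f tm list"

datatype ('f, 'p) atm = Atm 'p "'f tm list"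

datatype ('f, 'p) lit = Pos (atm_of: "('f, 'p) atm") | Neg (atm_of: "('f, 'p) atm")

datatype ('f, 'p) clause = Clause (head: "('f, 'p) atm") (body: "('f, 'p) lit list")

datatype ('f, 'p) fm =
    FAtom "('f, 'p) atm"
  | FNot "('f, 'p) fm"
  | FAnd "('f, 'p) fm" "('f, 'p) fm"
  | FOr "('f, 'p) fm" "('f, 'p) fm"
  | FImp "('f, 'p) fm" "('f, 'p) fm"
  | FIff "('f, 'p) fm" "('f, 'p) fm"
  | FAll nat "('f, 'p) fm"
  | FEx nat "('f, 'p) fm"

text \<open>A language is given by its function symbols (constants have arity 0) and its predicate
  symbols, each paired with its arity.\<close>

record ('f, 'p) language =
  fun_syms :: "('f \<times> nat) set"
  pred_syms :: "('p \<times> nat) set"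

fun wf_tm :: "('f, 'p) language \<Rightarrow> 'f tm \<Rightarrow> bool" where
  "wf_tm L (Var x) \<longleftrightarrow> True"
| "wf_tm L (Fun f ts) \<longleftrightarrow> (f, length ts) \<in> fun_syms L \<and> (\<forall>t \<in> set ts. wf_tm L t)"

primrec vars_tm :: "'f tm \<Rightarrow> nat set" where
  "vars_tm (Var x) = {x}"
| "vars_tm (Fun f ts) = \<Union> (set (map vars_tm ts))"

primrec subst_tm :: "(nat \<Rightarrow> 'f tm) \<Rightarrow> 'f tm \<Rightarrow> 'f tm" where
  "subst_tm \<sigma> (Var x) = \<sigma> x"
| "subst_tm \<sigma> (Fun f ts) = Fun f (map (subst_tm \<sigma>) ts)"

primrec wf_atm :: "('f, 'p) language \<Rightarrow> ('f, 'p) atm \<Rightarrow> bool" where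
  "wf_atm L (Atm p ts) \<longleftrightarrow> (p, length ts) \<in> pred_syms L \<and> (\<forall>t \<in> set ts. wf_tm L t)"

primrec vars_atm :: "('f, 'p) atm \<Rightarrow> nat set" where
  "vars_atm (Atm p ts) = (\<Union>t \<in> set ts. vars_tm t)"

primrec subst_atm :: "(nat \<Rightarrow> 'f tm) \<Rightarrow> ('f, 'p) atm \<Rightarrow> ('f, 'p) atm" where
  "subst_atm \<sigma> (Atm p ts) = Atm p (map (subst_tm \<sigma>) ts)"

primrec subst_lit :: "(nat \<Rightarrow> 'f tm) \<Rightarrow> ('f, 'p) lit \<Rightarrow> ('f, 'p) lit" where
  "subst_lit \<sigma> (Pos A) = Pos (subst_atm \<sigma> A)"
| "subst_lit \<sigma> (Neg A) = Neg (subst_atm \<sigma> A)"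

definition clause_atms :: "('f, 'p) clause \<Rightarrow> ('f, 'p) atm set" where
  "clause_atms c = insert (head c) (atm_of ` set (body c))"

definition subst_clause :: "(nat \<Rightarrow> 'f tm) \<Rightarrow> ('f, 'p) clause \<Rightarrow> ('f, 'p) clause" where
  "subst_clause \<sigma> c = Clause (subst_atm \<sigma> (head c)) (map (subst_lit \<sigma>) (body c))"

definition herbrand_universe :: "('f, 'p) language \<Rightarrow> 'f tm set" where
  "herbrand_universe L = {t. wf_tm L t \<and> vars_tm t = {}}"

definition herbrand_base :: "('f, 'p) language \<Rightarrow> ('f, 'p) atm set" where
  "herbrand_base L = {A. wf_atm L A \<and> vars_atm A = {}}"

definition ground_instances_atm ::
    "('f, 'p) language \<Rightarrow> ('f, 'p) atm \<Rightarrow> ('f, 'p) atm set" where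
  "ground_instances_atm L A =
     {subst_atm \<sigma> A | \<sigma>. \<forall>x \<in> vars_atm A. \<sigma> x \<in> herbrand_universe L}"

definition ground_program ::
    "('f, 'p) language \<Rightarrow> ('f, 'p) clause set \<Rightarrow> ('f, 'p) clause set" where
  "ground_program L P =
     {subst_clause \<sigma> c | \<sigma> c.
        c \<in> P \<and> (\<forall>x \<in> (\<Union>A \<in> clause_atms c. vars_atm A). \<sigma> x \<in> herbrand_universe L)}"

primrec atoms_fm :: "('f, 'p) fm \<Rightarrow> ('f, 'p) atm set" where
  "atoms_fm (FAtom A) = {A}"
| "atoms_fm (FNot \<phi>) = atoms_fm \<phi>"
| "atoms_fm (FAnd \<phi> \<psi>) = atoms_fm \<phi> \<union> atoms_fm \<psi>"
| "atoms_fm (FOr \<phi> \<psi>) = atoms_fm \<phi> \<union> atoms_fm \<psi>"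
| "atoms_fm (FImp \<phi> \<psi>) = atoms_fm \<phi> \<union> atoms_fm \<psi>"
| "atoms_fm (FIff \<phi> \<psi>) = atoms_fm \<phi> \<union> atoms_fm \<psi>"
| "atoms_fm (FAll x \<phi>) = atoms_fm \<phi>"
| "atoms_fm (FEx x \<phi>) = atoms_fm \<phi>"

primrec free_vars :: "('f, 'p) fm \<Rightarrow> nat set" where
  "free_vars (FAtom A) = vars_atm A"
| "free_vars (FNot \<phi>) = free_vars \<phi>"
| "free_vars (FAnd \<phi> \<psi>) = free_vars \<phi> \<union> free_vars \<psi>"
| "free_vars (FOr \<phi> \<psi>) = free_vars \<phi> \<union> free_vars \<psi>"
| "free_vars (FImp \<phi> \<psi>) = free_vars \<phi> \<union> free_vars \<psi>"
| "free_vars (FIff \<phi> \<psi>) = free_vars \<phi> \<union> free_vars \<psi>"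
| "free_vars (FAll x \<phi>) = free_vars \<phi> - {x}"
| "free_vars (FEx x \<phi>) = free_vars \<phi> - {x}"

definition sentences :: "('f, 'p) language \<Rightarrow> ('f, 'p) fm set" where
  "sentences L = {\<phi>. (\<forall>A \<in> atoms_fm \<phi>. wf_atm L A) \<and> free_vars \<phi> = {}}"

text \<open>\<open>inst x t \<phi>\<close> replaces the free occurrences of \<open>x\<close> by \<open>t\<close>. It is only used for ground \<open>t\<close>,
  so no variable can be captured.\<close>

primrec inst :: "nat \<Rightarrow> 'f tm \<Rightarrow> ('f, 'p) fm \<Rightarrow> ('f, 'p) fm" where
  "inst x t (FAtom A) = FAtom (subst_atm (Var(x := t)) A)"
| "inst x t (FNot \<phi>) = FNot (inst x t \<phi>)"
| "inst x t (FAnd \<phi> \<psi>) = FAnd (inst x t \<phi>) (inst x t \<psi>)"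
| "inst x t (FOr \<phi> \<psi>) = FOr (inst x t \<phi>) (inst x t \<psi>)"
| "inst x t (FImp \<phi> \<psi>) = FImp (inst x t \<phi>) (inst x t \<psi>)"
| "inst x t (FIff \<phi> \<psi>) = FIff (inst x t \<phi>) (inst x t \<psi>)"
| "inst x t (FAll y \<phi>) = FAll y (if y = x then \<phi> else inst x t \<phi>)"
| "inst x t (FEx y \<phi>) = FEx y (if y = x then \<phi> else inst x t \<phi>)"

primrec fm_rank :: "('f, 'p) fm \<Rightarrow> nat" where
  "fm_rank (FAtom A) = 0"
| "fm_rank (FNot \<phi>) = Suc (fm_rank \<phi>)"
| "fm_rank (FAnd \<phi> \<psi>) = Suc (fm_rank \<phi> + fm_rank \<psi>)"
| "fm_rank (FOr \<phi> \<psi>) = Suc (fm_rank \<phi> + fm_rank \<psi>)"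
| "fm_rank (FImp \<phi> \<psi>) = Suc (fm_rank \<phi> + fm_rank \<psi>)"
| "fm_rank (FIff \<phi> \<psi>) = Suc (fm_rank \<phi> + fm_rank \<psi>)"
| "fm_rank (FAll x \<phi>) = Suc (fm_rank \<phi>)"
| "fm_rank (FEx x \<phi>) = Suc (fm_rank \<phi>)"

lemma fm_rank_inst [simp]: "fm_rank (inst x t \<phi>) = fm_rank \<phi>"
  by (induction \<phi>) auto


section \<open>Acyclic programs and abductive interpretations\<close>

definition level_mapping ::
    "('f, 'p) language \<Rightarrow> ('f, 'p) clause set \<Rightarrow> ('f, 'p) atm set \<Rightarrow> (('f, 'p) atm \<Rightarrow> nat) \<Rightarrow> bool"
where
  "level_mapping L P Ab lvl \<longleftrightarrow>
     (\<forall>c \<in> ground_program L P. \<forall>l \<in> set (body c). lvl (atm_of l) < lvl (head c)) \<and>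
     (\<forall>A \<in> herbrand_base L. lvl A = 0 \<longleftrightarrow> A \<in> Ab)"

text \<open>The guard \<open>lvl (atm_of l) < lvl A\<close> is only there for termination: it always holds when \<open>lvl\<close>
  is a level mapping and \<open>G\<close> the ground instantiation of the program
  (see \<open>atom_true_iff\<close> below).\<close>

declare conj_cong [fundef_cong]

function atom_true_wrt ::
    "(('f, 'p) atm \<Rightarrow> nat) \<Rightarrow> ('f, 'p) clause set \<Rightarrow> ('f, 'p) atm set \<Rightarrow> ('f, 'p) atm \<Rightarrow> bool"
where
  "atom_true_wrt lvl G I A \<longleftrightarrow>
     (if lvl A = 0 then A \<in> I
      else \<exists>c \<in> G. head c = A \<and>
             (\<forall>l \<in> set (body c). lvl (atm_of l) < lvl A \<and>
                (case l of Pos B \<Rightarrow> atom_true_wrt lvl G I B | Neg B \<Rightarrow> \<not> atom_true_wrt lvl G I B)))"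
  by pat_completeness auto
termination
  by (relation "measure (\<lambda>(lvl, _, _, A). lvl A)") auto

declare atom_true_wrt.simps [simp del]

text \<open>The truth value does not depend on the chosen level mapping
  (see \<open>atom_true_level_independent\<close> below).\<close>

definition atom_true ::
    "('f, 'p) language \<Rightarrow> ('f, 'p) clause set \<Rightarrow> ('f, 'p) atm set \<Rightarrow> ('f, 'p) atm set
      \<Rightarrow> ('f, 'p) atm \<Rightarrow> bool"
where
  "atom_true L P Ab I A =
     atom_true_wrt (SOME lvl. level_mapping L P Ab lvl) (ground_program L P) I A"

text \<open>\<open>U\<close> is the set of ground terms used to instantiate quantifiers, \<open>v\<close> gives the truth values
  of the ground atoms.\<close>

function holds :: "'f tm set \<Rightarrow> (('f, 'p) atm \<Rightarrow> bool) \<Rightarrow> ('f, 'p) fm \<Rightarrow> bool" where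
  "holds U v (FAtom A) \<longleftrightarrow> v A"
| "holds U v (FNot \<phi>) \<longleftrightarrow> \<not> holds U v \<phi>"
| "holds U v (FAnd \<phi> \<psi>) \<longleftrightarrow> holds U v \<phi> \<and> holds U v \<psi>"
| "holds U v (FOr \<phi> \<psi>) \<longleftrightarrow> holds U v \<phi> \<or> holds U v \<psi>"
| "holds U v (FImp \<phi> \<psi>) \<longleftrightarrow> (holds U v \<phi> \<longrightarrow> holds U v \<psi>)"
| "holds U v (FIff \<phi> \<psi>) \<longleftrightarrow> (holds U v \<phi> \<longleftrightarrow> holds U v \<psi>)"
| "holds U v (FAll x \<phi>) \<longleftrightarrow> (\<forall>t \<in> U. holds U v (inst x t \<phi>))"
| "holds U v (FEx x \<phi>) \<longleftrightarrow> (\<exists>t \<in> U. holds U v (inst x t \<phi>))"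
  by pat_completeness auto
termination
  by (relation "measure (\<lambda>(_, _, \<phi>). fm_rank \<phi>)") auto

definition Mod ::
    "('f, 'p) language \<Rightarrow> ('f, 'p) clause set \<Rightarrow> ('f, 'p) atm set \<Rightarrow> ('f, 'p) fm set
      \<Rightarrow> ('f, 'p) atm set set"
where
  "Mod L P Ab X =
     {I. I \<subseteq> Ab \<and> (\<forall>\<phi> \<in> X. holds (herbrand_universe L) (atom_true L P Ab I) \<phi>)}"

definition Cn ::
    "('f, 'p) language \<Rightarrow> ('f, 'p) clause set \<Rightarrow> ('f, 'p) atm set \<Rightarrow> ('f, 'p) fm set
      \<Rightarrow> ('f, 'p) fm set"
where
  "Cn L P Ab X = {\<alpha> \<in> sentences L. Mod L P Ab X \<subseteq> Mod L P Ab {\<alpha>}}"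


section \<open>Horn knowledge bases\<close>

record ('f, 'p) kb =
  prog :: "('f, 'p) clause set"
  abds :: "('f, 'p) atm set"
  ics :: "('f, 'p) fm set"
  knowledge :: "('f, 'p) fm set"

text \<open>Abducibles are ground atoms. A non-ground atom inside a quantified sentence of the knowledge
  part counts as abducible if all its ground instances are; for a ground atom this is plain
  membership.\<close>

definition horn_kb :: "('f, 'p) language \<Rightarrow> ('f, 'p) kb \<Rightarrow> bool" where
  "horn_kb L KB \<longleftrightarrow>
     (\<forall>c \<in> prog KB. \<forall>A \<in> clause_atms c. wf_atm L A) \<and>
     abds KB \<subseteq> herbrand_base L \<and>
     (\<exists>lvl. level_mapping L (prog KB) (abds KB) lvl) \<and>
     ics KB \<subseteq> sentences L \<and>
     knowledge KB \<subseteq> sentences L \<and>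
     (\<forall>\<phi> \<in> knowledge KB. \<forall>A \<in> atoms_fm \<phi>. ground_instances_atm L A \<subseteq> abds KB)"

definition ModKB :: "('f, 'p) language \<Rightarrow> ('f, 'p) kb \<Rightarrow> ('f, 'p) atm set set" where
  "ModKB L KB = Mod L (prog KB) (abds KB) (knowledge KB \<union> ics KB)"

definition kb_closure :: "('f, 'p) language \<Rightarrow> ('f, 'p) kb \<Rightarrow> ('f, 'p) fm set" where
  "kb_closure L KB = Cn L (prog KB) (abds KB) (knowledge KB \<union> ics KB)"

definition accepted :: "('f, 'p) language \<Rightarrow> ('f, 'p) kb \<Rightarrow> ('f, 'p) fm \<Rightarrow> bool" where
  "accepted L KB \<alpha> \<longleftrightarrow> \<alpha> \<in> kb_closure L KB"

definition kb_equiv :: "('f, 'p) language \<Rightarrow> ('f, 'p) kb \<Rightarrow> ('f, 'p) kb \<Rightarrow> bool" where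
  "kb_equiv L KB1 KB2 \<longleftrightarrow>
     prog KB1 = prog KB2 \<and> abds KB1 = abds KB2 \<and> ics KB1 = ics KB2 \<and>
     Mod L (prog KB1) (abds KB1) (knowledge KB1) = Mod L (prog KB2) (abds KB2) (knowledge KB2)"

definition revision_function ::
    "('f, 'p) language \<Rightarrow> (('f, 'p) kb \<Rightarrow> ('f, 'p) fm \<Rightarrow> ('f, 'p) kb) \<Rightarrow> bool"
where
  "revision_function L revise \<longleftrightarrow>
     (\<forall>KB \<alpha>. horn_kb L KB \<longrightarrow> \<alpha> \<in> sentences L \<longrightarrow> horn_kb L (revise KB \<alpha>))"

text \<open>The postulates for the revisions of the given knowledge base \<open>KB\<close> by arbitrary sentences; only
  the fifth one, independence of syntax, also refers to revisions of another knowledge base.\<close>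

definition revision_postulates ::
    "('f, 'p) language \<Rightarrow> (('f, 'p) kb \<Rightarrow> ('f, 'p) fm \<Rightarrow> ('f, 'p) kb) \<Rightarrow> ('f, 'p) kb \<Rightarrow> bool"
where
  "revision_postulates L revise KB \<longleftrightarrow>
     (let S = sentences L; M = (\<lambda>X. Mod L (prog KB) (abds KB) X) in
      (\<forall>\<alpha> \<in> S. prog (revise KB \<alpha>) = prog KB \<and> abds (revise KB \<alpha>) = abds KB \<and> ics (revise KB \<alpha>) = ics KB) \<and>
      (\<forall>\<alpha> \<in> S. accepted L (revise KB \<alpha>) \<alpha>) \<and>
      (\<forall>\<alpha> \<in> S. M ({\<alpha>} \<union> ics KB) \<noteq> {} \<longleftrightarrow> ModKB L (revise KB \<alpha>) \<noteq> {}) \<and>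
      (\<forall>\<alpha> \<in> S. \<not> accepted L KB (FNot \<alpha>) \<longrightarrow> ModKB L (revise KB \<alpha>) = ModKB L KB \<inter> M {\<alpha>}) \<and>
      (\<forall>KB'. \<forall>\<alpha> \<in> S. \<forall>\<beta> \<in> S. horn_kb L KB' \<longrightarrow> kb_equiv L KB KB' \<longrightarrow> M {\<alpha>} = M {\<beta>} \<longrightarrow>
         ModKB L (revise KB \<alpha>) = ModKB L (revise KB' \<beta>)) \<and>
      (\<forall>\<alpha> \<in> S. \<forall>\<beta> \<in> S. ModKB L (revise KB \<alpha>) \<inter> M {\<beta>} \<subseteq> ModKB L (revise KB (FAnd \<alpha> \<beta>))) \<and>
      (\<forall>\<alpha> \<in> S. \<forall>\<beta> \<in> S. \<not> accepted L (revise KB \<alpha>) (FNot \<beta>) \<longrightarrow>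
         ModKB L (revise KB (FAnd \<alpha> \<beta>)) \<subseteq> ModKB L (revise KB \<alpha>) \<inter> M {\<beta>}))"


section \<open>AGM revision of a belief set\<close>

definition belief_set ::
    "('f, 'p) language \<Rightarrow> ('f, 'p) clause set \<Rightarrow> ('f, 'p) atm set \<Rightarrow> ('f, 'p) fm set \<Rightarrow> bool"
where
  "belief_set L P Ab T \<longleftrightarrow> T \<subseteq> sentences L \<and> T = Cn L P Ab T"

definition expansion ::
    "('f, 'p) language \<Rightarrow> ('f, 'p) clause set \<Rightarrow> ('f, 'p) atm set \<Rightarrow> ('f, 'p) fm set
      \<Rightarrow> ('f, 'p) fm \<Rightarrow> ('f, 'p) fm set"
where
  "expansion L P Ab T \<alpha> = Cn L P Ab (T \<union> {\<alpha>})"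

definition inconsistent :: "('f, 'p) fm set \<Rightarrow> bool" where
  "inconsistent T \<longleftrightarrow> (\<exists>\<phi>. \<phi> \<in> T \<and> FNot \<phi> \<in> T)"

definition agm_revision_postulates ::
    "('f, 'p) language \<Rightarrow> ('f, 'p) clause set \<Rightarrow> ('f, 'p) atm set
      \<Rightarrow> (('f, 'p) fm set \<Rightarrow> ('f, 'p) fm \<Rightarrow> ('f, 'p) fm set) \<Rightarrow> ('f, 'p) fm set \<Rightarrow> bool"
where
  "agm_revision_postulates L P Ab star T \<longleftrightarrow>
     (let S = sentences L; expand = expansion L P Ab; valid = (\<lambda>\<phi>. \<phi> \<in> Cn L P Ab {}) in
      (\<forall>\<alpha> \<in> S. belief_set L P Ab (star T \<alpha>)) \<and>
      (\<forall>\<alpha> \<in> S. \<alpha> \<in> star T \<alpha>) \<and>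
      (\<forall>\<alpha> \<in> S. star T \<alpha> \<subseteq> expand T \<alpha>) \<and>
      (\<forall>\<alpha> \<in> S. FNot \<alpha> \<notin> T \<longrightarrow> expand T \<alpha> \<subseteq> star T \<alpha>) \<and>
      (\<forall>\<alpha> \<in> S. inconsistent (star T \<alpha>) \<longleftrightarrow> valid (FNot \<alpha>)) \<and>
      (\<forall>\<alpha> \<in> S. \<forall>\<beta> \<in> S. valid (FIff \<alpha> \<beta>) \<longrightarrow> star T \<alpha> = star T \<beta>) \<and>
      (\<forall>\<alpha> \<in> S. \<forall>\<beta> \<in> S. star T (FAnd \<alpha> \<beta>) \<subseteq> expand (star T \<alpha>) \<beta>) \<and>
      (\<forall>\<alpha> \<in> S. \<forall>\<beta> \<in> S. FNot \<beta> \<notin> star T \<alpha> \<longrightarrow>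
         expand (star T \<alpha>) \<beta> \<subseteq> star T (FAnd \<alpha> \<beta>)))"


section \<open>Well-definedness of the truth of ground atoms\<close>

lemma subst_tm_ground:
  assumes "wf_tm L t" and "\<forall>x \<in> vars_tm t. \<sigma> x \<in> herbrand_universe L"
  shows "subst_tm \<sigma> t \<in> herbrand_universe L"
  using assms
proof (induction t)
  case (Var x)
  then show ?case by simp
next
  case (Fun f ts)
  have "\<forall>t \<in> set ts. subst_tm \<sigma> t \<in> herbrand_universe L"
  proof
    fix t assume t: "t \<in> set ts"
    show "subst_tm \<sigma> t \<in> herbrand_universe L"
      by (rule Fun.IH[OF t]) (use Fun.prems t in auto)
  qed
  then show ?case using Fun.prems by (auto simp: herbrand_universe_def)
qed

lemma subst_atm_ground:
  assumes "wf_atm L A" and "\<forall>x \<in> vars_atm A. \<sigma> x \<in> herbrand_universe L"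
  shows "subst_atm \<sigma> A \<in> herbrand_base L"
proof (cases A)
  case (Atm p ts)
  have "\<forall>t \<in> set ts. subst_tm \<sigma> t \<in> herbrand_universe L"
    using assms Atm by (auto intro!: subst_tm_ground)
  then show ?thesis using assms Atm by (auto simp: herbrand_base_def herbrand_universe_def)
qed

lemma atm_of_subst_lit [simp]: "atm_of (subst_lit \<sigma> l) = subst_atm \<sigma> (atm_of l)"
  by (cases l) auto

lemma ground_program_atms:
  assumes "\<forall>c \<in> P. \<forall>A \<in> clause_atms c. wf_atm L A" and "c \<in> ground_program L P"
    and "A \<in> clause_atms c"
  shows "A \<in> herbrand_base L"
proof -
  obtain \<sigma> c' where c: "c = subst_clause \<sigma> c'" "c' \<in> P"
    and \<sigma>: "\<forall>B \<in> clause_atms c'. \<forall>x \<in> vars_atm B. \<sigma> x \<in> herbrand_universe L"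
    using assms(2) by (auto simp: ground_program_def)
  from assms(3) obtain B where "A = subst_atm \<sigma> B" "B \<in> clause_atms c'"
    unfolding c(1) subst_clause_def clause_atms_def by auto
  then show ?thesis using assms(1) c(2) \<sigma> by (simp add: subst_atm_ground)
qed

lemma atom_true_wrt_unfold:
  assumes P: "\<forall>c \<in> P. \<forall>A \<in> clause_atms c. wf_atm L A" and lvl: "level_mapping L P Ab lvl"
    and A: "A \<in> herbrand_base L"
  shows "atom_true_wrt lvl (ground_program L P) I A \<longleftrightarrow>
    (if A \<in> Ab then A \<in> I
     else \<exists>c \<in> ground_program L P. head c = A \<and>
       (\<forall>l \<in> set (body c). case l of
            Pos B \<Rightarrow> atom_true_wrt lvl (ground_program L P) I B
          | Neg B \<Rightarrow> \<not> atom_true_wrt lvl (ground_program L P) I B))"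
proof -
  have 1: "lvl A = 0 \<longleftrightarrow> A \<in> Ab" using lvl A by (auto simp: level_mapping_def)
  have 2: "\<And>c l. c \<in> ground_program L P \<Longrightarrow> l \<in> set (body c) \<Longrightarrow> lvl (atm_of l) < lvl (head c)"
    using lvl by (auto simp: level_mapping_def)
  show ?thesis
    by (subst atom_true_wrt.simps) (use 1 2 in \<open>auto; blast\<close>)
qed

lemma atom_true_wrt_unique:
  assumes P: "\<forall>c \<in> P. \<forall>A \<in> clause_atms c. wf_atm L A" and lvl: "level_mapping L P Ab lvl"
    and lvl': "level_mapping L P Ab lvl'" and A: "A \<in> herbrand_base L"
  shows "atom_true_wrt lvl (ground_program L P) I A \<longleftrightarrow> atom_true_wrt lvl' (ground_program L P) I A"
  using A
proof (induction "lvl A" arbitrary: A rule: less_induct)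
  case less
  have IH: "atom_true_wrt lvl (ground_program L P) I (atm_of l) \<longleftrightarrow>
            atom_true_wrt lvl' (ground_program L P) I (atm_of l)"
    if "c \<in> ground_program L P" "head c = A" "l \<in> set (body c)" for c l
  proof (rule less.hyps)
    show "lvl (atm_of l) < lvl A" using lvl that by (auto simp: level_mapping_def)
    show "atm_of l \<in> herbrand_base L"
      using ground_program_atms[OF P that(1)] that(3) by (auto simp: clause_atms_def)
  qed
  have cong: "(case l of Pos B \<Rightarrow> atom_true_wrt lvl (ground_program L P) I B
                | Neg B \<Rightarrow> \<not> atom_true_wrt lvl (ground_program L P) I B) \<longleftrightarrow>
              (case l of Pos B \<Rightarrow> atom_true_wrt lvl' (ground_program L P) I B
                | Neg B \<Rightarrow> \<not> atom_true_wrt lvl' (ground_program L P) I B)"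
    if "c \<in> ground_program L P" "head c = A" "l \<in> set (body c)" for c l
    using IH[OF that] by (cases l) auto
  show ?case
    unfolding atom_true_wrt_unfold[OF P lvl less.prems] atom_true_wrt_unfold[OF P lvl' less.prems]
    using cong by (simp cong: conj_cong bex_cong ball_cong)
qed

lemma atom_true_level_independent:
  assumes "horn_kb L KB" and "level_mapping L (prog KB) (abds KB) lvl" and "A \<in> herbrand_base L"
  shows "atom_true L (prog KB) (abds KB) I A \<longleftrightarrow> atom_true_wrt lvl (ground_program L (prog KB)) I A"
  unfolding atom_true_def
proof (rule atom_true_wrt_unique)
  show "level_mapping L (prog KB) (abds KB) (SOME lvl. level_mapping L (prog KB) (abds KB) lvl)"
    using someI[of "level_mapping L (prog KB) (abds KB)", OF assms(2)] .
  show "\<forall>c \<in> prog KB. \<forall>A \<in> clause_atms c. wf_atm L A"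
    using assms(1) by (simp add: horn_kb_def)
qed (fact assms(2), fact assms(3))

lemma atom_true_iff:
  assumes "horn_kb L KB" and "A \<in> herbrand_base L"
  shows "atom_true L (prog KB) (abds KB) I A \<longleftrightarrow>
    (if A \<in> abds KB then A \<in> I
     else \<exists>c \<in> ground_program L (prog KB). head c = A \<and>
       (\<forall>l \<in> set (body c). case l of
            Pos B \<Rightarrow> atom_true L (prog KB) (abds KB) I B
          | Neg B \<Rightarrow> \<not> atom_true L (prog KB) (abds KB) I B))"
proof -
  have "level_mapping L (prog KB) (abds KB) (SOME lvl. level_mapping L (prog KB) (abds KB) lvl)"
    using assms(1) someI_ex[of "level_mapping L (prog KB) (abds KB)"] by (simp add: horn_kb_def)
  moreover have "\<forall>c \<in> prog KB. \<forall>A \<in> clause_atms c. wf_atm L A"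
    using assms(1) by (auto simp: horn_kb_def)
  ultimately show ?thesis
    unfolding atom_true_def by (intro atom_true_wrt_unfold assms(2))
qed

end

theory Submission
  imports Defs
begin

text \<open>Every belief set that occurs is \<open>Cn\<close> of a set of sentences, and \<open>Cn\<close> is antitone in the set of
  models. Since \<open>Mod\<close> of \<open>Cn X\<close> is \<open>Mod X\<close>, and expansion intersects the model sets, each AGM
  postulate translates into a statement about model sets, which is one of the postulates for
  knowledge bases. An empty set of integrity constraints makes the third of these say exactly when
  a revision is inconsistent.\<close>

lemma sentences_FNot [simp]: "FNot \<alpha> \<in> sentences L \<longleftrightarrow> \<alpha> \<in> sentences L"
  by (simp add: sentences_def)

lemma sentences_FAnd [simp]:
  "FAnd \<alpha> \<beta> \<in> sentences L \<longleftrightarrow> \<alpha> \<in> sentences L \<and> \<beta> \<in> sentences L"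
  by (auto simp: sentences_def)

lemma Mod_Un: "Mod L P Ab (X \<union> Y) = Mod L P Ab X \<inter> Mod L P Ab Y"
  by (auto simp: Mod_def)

lemma Mod_FNot: "Mod L P Ab {FNot \<alpha>} = Pow Ab - Mod L P Ab {\<alpha>}"
  by (auto simp: Mod_def)

lemma Mod_subset_Pow: "Mod L P Ab X \<subseteq> Pow Ab"
  by (auto simp: Mod_def)

lemma Cn_subset_sentences: "Cn L P Ab X \<subseteq> sentences L"
  by (auto simp: Cn_def)

text \<open>\<open>Cn\<close> collects only sentences, so the hypothesis is what puts
  \<open>X\<close> inside its own closure and gives the first inclusion. The second holds because
  each member of \<open>Cn\<close> is true in every model of \<open>X\<close>.\<close>

lemma Mod_Cn:
  assumes "X \<subseteq> sentences L"
  shows "Mod L P Ab (Cn L P Ab X) = Mod L P Ab X"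
proof
  have "X \<subseteq> Cn L P Ab X"
    using assms by (auto simp: Cn_def Mod_def)
  then show "Mod L P Ab (Cn L P Ab X) \<subseteq> Mod L P Ab X"
    unfolding Mod_def by blast
  show "Mod L P Ab X \<subseteq> Mod L P Ab (Cn L P Ab X)"
  proof
    fix I assume "I \<in> Mod L P Ab X"
    then have "I \<subseteq> Ab" and "\<forall>\<phi> \<in> Cn L P Ab X. I \<in> Mod L P Ab {\<phi>}"
      using Mod_subset_Pow unfolding Cn_def by blast+
    then show "I \<in> Mod L P Ab (Cn L P Ab X)"
      by (simp add: Mod_def)
  qed
qed

lemma Cn_antimono:
  assumes "Mod L P Ab Y \<subseteq> Mod L P Ab X"
  shows "Cn L P Ab X \<subseteq> Cn L P Ab Y"
  using assms by (auto simp: Cn_def)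

text \<open>An interpretation makes exactly one of \<alpha> and its negation true. This turns the
  guards "the negation is not believed" into satisfiability conditions on model sets.\<close>

lemma FNot_mem_Cn_iff:
  assumes "\<alpha> \<in> sentences L"
  shows "FNot \<alpha> \<in> Cn L P Ab X \<longleftrightarrow> Mod L P Ab X \<inter> Mod L P Ab {\<alpha>} = {}"
  using assms Mod_subset_Pow[of L P Ab X] by (auto simp: Cn_def Mod_FNot)

text \<open>\<alpha> only witnesses that some sentence exists: in a language without predicate
  symbols every closure is empty and hence never inconsistent.\<close>

lemma inconsistent_Cn_iff:
  assumes "\<alpha> \<in> sentences L"
  shows "inconsistent (Cn L P Ab X) \<longleftrightarrow> Mod L P Ab X = {}"
proof
  assume "inconsistent (Cn L P Ab X)"
  then show "Mod L P Ab X = {}"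
    by (auto simp: inconsistent_def Cn_def Mod_FNot)
next
  assume "Mod L P Ab X = {}"
  then have "\<alpha> \<in> Cn L P Ab X" "FNot \<alpha> \<in> Cn L P Ab X"
    using assms by (auto simp: Cn_def)
  then show "inconsistent (Cn L P Ab X)"
    unfolding inconsistent_def by blast
qed

lemma FIff_mem_Cn_empty_imp_Mod_eq:
  assumes "FIff \<alpha> \<beta> \<in> Cn L P Ab {}"
  shows "Mod L P Ab {\<alpha>} = Mod L P Ab {\<beta>}"
  using assms by (auto simp: Cn_def Mod_def)

text \<open>\<open>Cn\<close> depends on a set only through its models, and closing the set does not
  change these.\<close>

lemma belief_set_Cn:
  assumes "X \<subseteq> sentences L"
  shows "belief_set L P Ab (Cn L P Ab X)"
  unfolding belief_set_def
proof
  show "Cn L P Ab X \<subseteq> sentences L"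
    by (rule Cn_subset_sentences)
  show "Cn L P Ab X = Cn L P Ab (Cn L P Ab X)"
    by (intro equalityI Cn_antimono) (simp_all add: Mod_Cn[OF assms])
qed

lemma Mod_Cn_insert:
  assumes "X \<subseteq> sentences L"
  shows "Mod L P Ab (Cn L P Ab X \<union> {\<alpha>}) = Mod L P Ab X \<inter> Mod L P Ab {\<alpha>}"
  by (simp only: Mod_Un Mod_Cn[OF assms])

theorem theorem6:
  fixes L :: "('f, 'p) language"
    and KB :: "('f, 'p) kb"
    and revise :: "('f, 'p) kb \<Rightarrow> ('f, 'p) fm \<Rightarrow> ('f, 'p) kb"
    and star :: "('f, 'p) fm set \<Rightarrow> ('f, 'p) fm \<Rightarrow> ('f, 'p) fm set"
  assumes "horn_kb L KB"
    and "ics KB = {}"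
    and "revision_function L revise"
    and "revision_postulates L revise KB"
    and "\<forall>\<alpha> \<in> sentences L. star (kb_closure L KB) \<alpha> = kb_closure L (revise KB \<alpha>)"
  shows "agm_revision_postulates L (prog KB) (abds KB) star (kb_closure L KB)"
proof -
  let ?S = "sentences L"
  let ?M = "Mod L (prog KB) (abds KB)"
  let ?Cn = "Cn L (prog KB) (abds KB)"
  let ?T = "kb_closure L KB"
  let ?K = "knowledge KB"
  \<comment> \<open>The first postulate lets revision change only the knowledge part, so
    \<open>R\<close> carries all the information and \<open>?M\<close> and \<open>?Cn\<close> serve
    for every revision.\<close>
  define R where "R \<alpha> = knowledge (revise KB \<alpha>)" for \<alpha>
  note post = assms(4)[unfolded revision_postulates_def Let_def]
  note post1 = post[THEN conjunct1]
    and post2 = post[THEN conjunct2, THEN conjunct1]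
    and post3 = post[THEN conjunct2, THEN conjunct2, THEN conjunct1]
    and post4 = post[THEN conjunct2, THEN conjunct2, THEN conjunct2, THEN conjunct1]
    and post5 = post[THEN conjunct2, THEN conjunct2, THEN conjunct2, THEN conjunct2, THEN conjunct1]
    and post6 = post[THEN conjunct2, THEN conjunct2, THEN conjunct2, THEN conjunct2, THEN conjunct2,
      THEN conjunct1]
    and post7 = post[THEN conjunct2, THEN conjunct2, THEN conjunct2, THEN conjunct2, THEN conjunct2,
      THEN conjunct2]

  have frame: "prog (revise KB \<alpha>) = prog KB" "abds (revise KB \<alpha>) = abds KB" "ics (revise KB \<alpha>) = {}"
    if "\<alpha> \<in> ?S" for \<alpha>
    using post1 assms(2) that by auto
  have K: "?K \<subseteq> ?S" and T: "?T = ?Cn ?K" and ModKB: "ModKB L KB = ?M ?K"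
    using assms(1,2) by (simp_all add: horn_kb_def kb_closure_def ModKB_def)
  have R: "R \<alpha> \<subseteq> ?S" if "\<alpha> \<in> ?S" for \<alpha>
    using assms(1,3) that by (simp add: revision_function_def horn_kb_def R_def)
  have closure: "kb_closure L (revise KB \<alpha>) = ?Cn (R \<alpha>)" if "\<alpha> \<in> ?S" for \<alpha>
    using frame[OF that] by (simp add: kb_closure_def R_def)
  have star: "star ?T \<alpha> = ?Cn (R \<alpha>)" if "\<alpha> \<in> ?S" for \<alpha>
    using assms(5) closure[OF that] that by simp
  have ModR: "ModKB L (revise KB \<alpha>) = ?M (R \<alpha>)" if "\<alpha> \<in> ?S" for \<alpha>
    using frame[OF that] by (simp add: ModKB_def R_def)

  have success: "\<alpha> \<in> ?Cn (R \<alpha>)" if "\<alpha> \<in> ?S" for \<alpha>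
    using post2[rule_format, OF that] unfolding accepted_def closure[OF that] .
  have consistency: "?M {\<alpha>} = {} \<longleftrightarrow> ?M (R \<alpha>) = {}" if "\<alpha> \<in> ?S" for \<alpha>
    using post3 assms(2) ModR[OF that] that by auto
  have vacuity: "?M (R \<alpha>) = ?M ?K \<inter> ?M {\<alpha>}" if "\<alpha> \<in> ?S" "FNot \<alpha> \<notin> ?Cn ?K" for \<alpha>
    using post4 that ModR[OF that(1)] by (simp add: accepted_def T ModKB)
  have extensionality: "?M (R \<alpha>) = ?M (R \<beta>)" if "\<alpha> \<in> ?S" "\<beta> \<in> ?S" "?M {\<alpha>} = ?M {\<beta>}" for \<alpha> \<beta>
  proof -
    \<comment> \<open>Only the revising sentence varies in the AGM postulate, so the fifth postulate
      is taken with \<open>KB\<close> as its own equivalent.\<close>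
    have "kb_equiv L KB KB" by (simp add: kb_equiv_def)
    then have "ModKB L (revise KB \<alpha>) = ModKB L (revise KB \<beta>)"
      by (rule post5[rule_format, OF that(1,2) assms(1) _ that(3)])
    then show ?thesis using that by (simp add: ModR)
  qed
  have superexpansion: "?M (R \<alpha>) \<inter> ?M {\<beta>} \<subseteq> ?M (R (FAnd \<alpha> \<beta>))" if "\<alpha> \<in> ?S" "\<beta> \<in> ?S" for \<alpha> \<beta>
  proof -
    have "ModKB L (revise KB \<alpha>) \<inter> ?M {\<beta>} \<subseteq> ModKB L (revise KB (FAnd \<alpha> \<beta>))"
      using post6 that by blast
    then show ?thesis using that by (simp add: ModR)
  qed
  have subexpansion: "?M (R (FAnd \<alpha> \<beta>)) \<subseteq> ?M (R \<alpha>) \<inter> ?M {\<beta>}"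
    if "\<alpha> \<in> ?S" "\<beta> \<in> ?S" "FNot \<beta> \<notin> ?Cn (R \<alpha>)" for \<alpha> \<beta>
  proof -
    have "\<not> accepted L (revise KB \<alpha>) (FNot \<beta>)"
      using that by (simp add: accepted_def closure)
    then have "ModKB L (revise KB (FAnd \<alpha> \<beta>)) \<subseteq> ModKB L (revise KB \<alpha>) \<inter> ?M {\<beta>}"
      using post7 that by blast
    then show ?thesis using that by (simp add: ModR)
  qed

  \<comment> \<open>Unlike vacuity this has no guard: if the negation of \<alpha> is believed, the
    left side is empty.\<close>
  have inclusion: "?M ?K \<inter> ?M {\<alpha>} \<subseteq> ?M (R \<alpha>)" if "\<alpha> \<in> ?S" for \<alpha>
  proof (cases "FNot \<alpha> \<in> ?Cn ?K")
    case True
    then show ?thesis using that by (simp add: FNot_mem_Cn_iff)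
  next
    case False
    then show ?thesis using vacuity that by simp
  qed
  have inconsistency: "inconsistent (?Cn (R \<alpha>)) \<longleftrightarrow> FNot \<alpha> \<in> ?Cn {}" if "\<alpha> \<in> ?S" for \<alpha>
  proof -
    \<comment> \<open>All interpretations are models of the empty set, so the negation of \<alpha>
      is valid iff \<alpha> has no model.\<close>
    have "?M {} \<inter> ?M {\<alpha>} = ?M {\<alpha>}"
      by (auto simp: Mod_def)
    then show ?thesis
      using consistency that by (simp add: inconsistent_Cn_iff FNot_mem_Cn_iff)
  qed

  show ?thesis
    unfolding agm_revision_postulates_def Let_def expansion_def
  proof (intro conjI ballI impI)
    fix \<alpha> assume \<alpha>: "\<alpha> \<in> ?S"
    show "belief_set L (prog KB) (abds KB) (star ?T \<alpha>)"
      unfolding star[OF \<alpha>] by (rule belief_set_Cn[OF R[OF \<alpha>]])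
    show "\<alpha> \<in> star ?T \<alpha>"
      unfolding star[OF \<alpha>] by (rule success[OF \<alpha>])
    show "star ?T \<alpha> \<subseteq> ?Cn (?T \<union> {\<alpha>})"
      \<comment> \<open>The equation for \<open>star\<close> has \<open>?T\<close> as its argument,
        so it is applied before \<open>?T\<close> is replaced by \<open>?Cn ?K\<close>.\<close>
      unfolding star[OF \<alpha>] unfolding T
      by (rule Cn_antimono) (simp only: Mod_Cn_insert[OF K] inclusion[OF \<alpha>])
    show "inconsistent (star ?T \<alpha>) \<longleftrightarrow> FNot \<alpha> \<in> ?Cn {}"
      unfolding star[OF \<alpha>] by (rule inconsistency[OF \<alpha>])
  next
    fix \<alpha> assume \<alpha>: "\<alpha> \<in> ?S" and "FNot \<alpha> \<notin> ?T"
    then have "?M (R \<alpha>) = ?M ?K \<inter> ?M {\<alpha>}"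
      using vacuity by (simp add: T)
    then show "?Cn (?T \<union> {\<alpha>}) \<subseteq> star ?T \<alpha>"
      unfolding star[OF \<alpha>] unfolding T by (intro Cn_antimono) (simp only: Mod_Cn_insert[OF K])
  next
    fix \<alpha> \<beta> assume \<alpha>\<beta>: "\<alpha> \<in> ?S" "\<beta> \<in> ?S"
    then have conj: "FAnd \<alpha> \<beta> \<in> ?S" by simp
    show "star ?T \<alpha> = star ?T \<beta>" if "FIff \<alpha> \<beta> \<in> ?Cn {}"
      using extensionality[OF \<alpha>\<beta> FIff_mem_Cn_empty_imp_Mod_eq[OF that]]
      by (simp add: star \<alpha>\<beta> Cn_def)
    \<comment> \<open>Antitonicity reverses the inclusions: \<open>superexpansion\<close> bounds the
      revision by the conjunction from above, \<open>subexpansion\<close> from below.\<close>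
    show "star ?T (FAnd \<alpha> \<beta>) \<subseteq> ?Cn (star ?T \<alpha> \<union> {\<beta>})"
      unfolding star[OF conj] star[OF \<alpha>\<beta>(1)]
      by (rule Cn_antimono) (simp only: Mod_Cn_insert[OF R[OF \<alpha>\<beta>(1)]] superexpansion[OF \<alpha>\<beta>])
    show "?Cn (star ?T \<alpha> \<union> {\<beta>}) \<subseteq> star ?T (FAnd \<alpha> \<beta>)" if "FNot \<beta> \<notin> star ?T \<alpha>"
      using subexpansion[OF \<alpha>\<beta>] that unfolding star[OF conj] star[OF \<alpha>\<beta>(1)]
      by (intro Cn_antimono) (simp only: Mod_Cn_insert[OF R[OF \<alpha>\<beta>(1)]] not_False_eq_True)
  qed
qed

end
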